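(* For every integer $k\ge 3$, there exists a $4$-regular minimally $\frac{k+1}{k-1}$-tough graph of order $2k+1$.
   Context: All graphs are finite and simple. The order of a graph is its number of vertices. A graph is $r$-regular if every vertex has degree $r$. For a graph $G$, let $c(G)$ denote the number of connected components of $G$. For a nonnegative real number $t$, a graph $G$ is said to be $t$-tough if $t\cdot c(G-X)\le |X|$ for all $X\subseteq V(G)$ with $c(G-X)>1$, where $G-X$ is the graph obtained from $G$ by deleting the vertices in $X$. The toughness $\tau(G)$ of $G$ is the maximum value of $t$ such that $G$ is $t$-tough, with the convention $\tau(K_n)=\infty$ for all $n\ge 1$, where $K_n$ is the complete graph of order $n$. A graph $G$ is said to be minimally $t$-tough if $\tau(G)=t$ and $\tau(G-e)<t$ for every edge $e\in E(G)$, where $G-e$ is the graph obtained from $G$ by deleting the edge $e$ (keeping all vertices). *)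

theory Defs
  imports "HOL-Library.Extended_Real"
begin

text \<open>A finite simple graph is given by its vertex set \<open>V\<close> and its set \<open>E\<close> of edges, each edge being
  an unordered pair of distinct vertices.\<close>

definition simple_graph :: "'a set \<Rightarrow> 'a set set \<Rightarrow> bool" where
  "simple_graph V E \<longleftrightarrow> finite V \<and> (\<forall>e\<in>E. e \<subseteq> V \<and> card e = 2)"

definition regular_graph :: "nat \<Rightarrow> 'a set \<Rightarrow> 'a set set \<Rightarrow> bool" where
  "regular_graph r V E \<longleftrightarrow> (\<forall>v\<in>V. card {e \<in> E. v \<in> e} = r)"

definition complete_graph :: "'a set \<Rightarrow> 'a set set \<Rightarrow> bool" where
  "complete_graph V E \<longleftrightarrow> (\<forall>u\<in>V. \<forall>v\<in>V. u \<noteq> v \<longrightarrow> {u, v} \<in> E)"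

definition reach :: "'a set \<Rightarrow> 'a set set \<Rightarrow> ('a \<times> 'a) set" where
  "reach V E = {(u, v). u \<in> V \<and> v \<in> V \<and> (u, v) \<in> {(x, y). {x, y} \<in> E}\<^sup>*}"

definition num_components :: "'a set \<Rightarrow> 'a set set \<Rightarrow> nat" where
  "num_components V E = card (V // reach V E)"

definition delete_verts :: "'a set set \<Rightarrow> 'a set \<Rightarrow> 'a set set" where
  "delete_verts E X = {e \<in> E. e \<inter> X = {}}"

definition tough :: "real \<Rightarrow> 'a set \<Rightarrow> 'a set set \<Rightarrow> bool" where
  "tough t V E \<longleftrightarrow>
     (\<forall>X\<subseteq>V. num_components (V - X) (delete_verts E X) > 1 \<longrightarrow>
        t * real (num_components (V - X) (delete_verts E X)) \<le> real (card X))"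

text \<open>The maximum below exists for every simple graph that is not complete: see \<open>toughness_attained\<close>.\<close>

definition toughness :: "'a set \<Rightarrow> 'a set set \<Rightarrow> ereal" where
  "toughness V E =
     (if complete_graph V E then \<infinity> else ereal (GREATEST t. 0 \<le> t \<and> tough t V E))"

definition minimally_tough :: "real \<Rightarrow> 'a set \<Rightarrow> 'a set set \<Rightarrow> bool" where
  "minimally_tough t V E \<longleftrightarrow>
     toughness V E = ereal t \<and> (\<forall>e\<in>E. toughness V (E - {e}) < ereal t)"

lemma tough_maximum_exists:
  assumes "simple_graph V E" and "\<not> complete_graph V E"
  shows "\<exists>t. 0 \<le> t \<and> tough t V E \<and> (\<forall>s. tough s V E \<longrightarrow> s \<le> t)"
proof -
  define c where "c X = num_components (V - X) (delete_verts E X)" for X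
  define S where "S = {X. X \<subseteq> V \<and> c X > 1}"
  define q where "q X = real (card X) / real (c X)" for X
  have fV: "finite V" using assms(1) by (simp add: simple_graph_def)
  obtain u v where uv: "u \<in> V" "v \<in> V" "u \<noteq> v" "{u, v} \<notin> E"
    using assms(2) by (auto simp: complete_graph_def)
  have W: "V - (V - {u, v}) = {u, v}" using uv by blast
  have noedge: "delete_verts E (V - {u, v}) = {}"
  proof -
    have False if "e \<in> E" "e \<inter> (V - {u, v}) = {}" for e
    proof -
      have "e \<subseteq> V" "card e = 2" using assms(1) that(1) by (auto simp: simple_graph_def)
      hence "e \<subseteq> {u, v}" using that by blast
      moreover have "card {u, v} = 2" using uv(3) by simp
      ultimately have "e = {u, v}" using \<open>card e = 2\<close>
        by (metis card_subset_eq finite.emptyI finite.insertI)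
      thus False using that(1) uv(4) by blast
    qed
    thus ?thesis by (auto simp: delete_verts_def)
  qed
  have "reach {u, v} ({} :: 'a set set) = {(u, u), (v, v)}"
    by (auto simp: reach_def)
  hence "{u, v} // reach {u, v} {} = {{u}, {v}}"
    using uv(3) by (auto simp: quotient_def)
  hence "c (V - {u, v}) = 2" using uv(3)
    by (simp add: c_def num_components_def W noedge)
  hence "V - {u, v} \<in> S" by (simp add: S_def)
  hence ne: "S \<noteq> {}" by blast
  have fS: "finite S" using fV by (simp add: S_def)
  have iff: "tough s V E \<longleftrightarrow> (\<forall>X\<in>S. s \<le> q X)" for s
  proof -
    have "s * real (c X) \<le> real (card X) \<longleftrightarrow> s \<le> q X" if "X \<in> S" for X
      using that by (simp add: S_def q_def pos_le_divide_eq)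
    moreover have "tough s V E \<longleftrightarrow> (\<forall>X\<in>S. s * real (c X) \<le> real (card X))"
      unfolding tough_def S_def c_def by blast
    ultimately show ?thesis by blast
  qed
  have "0 \<le> Min (q ` S)" using fS ne by (simp add: q_def)
  moreover have "tough s V E \<longleftrightarrow> s \<le> Min (q ` S)" for s
    using fS ne by (simp add: iff)
  ultimately show ?thesis by blast
qed

lemma toughness_attained:
  assumes "simple_graph V E" and "\<not> complete_graph V E"
  obtains t where "toughness V E = ereal t" and "0 \<le> t" and "tough t V E"
    and "\<And>s. tough s V E \<Longrightarrow> s \<le> t"
proof -
  obtain t where t: "0 \<le> t" "tough t V E" "\<And>s. tough s V E \<Longrightarrow> s \<le> t"
    using tough_maximum_exists[OF assms] by blast
  have "(GREATEST t. 0 \<le> t \<and> tough t V E) = t"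
    by (rule Greatest_equality) (use t in auto)
  hence "toughness V E = ereal t" using assms(2) by (simp add: toughness_def)
  thus thesis using t that by blast
qed

end

theory Submission imports Defs begin

text \<open>The graph is the circulant graph on the integers modulo \<open>n = 2k + 1\<close> with jumps 1 and 3.
  If deleting \<open>X\<close> leaves \<open>c > 1\<close> components, then \<open>c + 2 \<le> |X|\<close>. Indeed, walking around
  the cycle, every component is left at least once into \<open>X\<close>, which gives \<open>c \<le> |X|\<close>. Two more
  elements of \<open>X\<close> come from a place where the walk is not an alternation between \<open>X\<close> and its
  complement, which exists as \<open>n\<close> is odd: the jumps of length 3 make the component found there
  be left repeatedly, unless three consecutive vertices belong to \<open>X\<close>. As \<open>c + |X| \<le> n\<close>, this
  yields \<open>c \<le> k - 1\<close> and the lower bound on the toughness. The vertices \<open>0, 3, 5, \<dots>, 2k - 1\<close>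
  span the single edge \<open>{0, 3}\<close>, and \<open>0, 1, 3, 5, \<dots>, 2k - 1\<close> span the path
  \<open>2k - 1, 1, 0, 3\<close> and isolated vertices. Up to rotation, these two sets show that the bound is
  attained and that the deletion of any edge lowers the toughness.\<close>

section \<open>Colourings of a cycle\<close>

lemma periodic_mod:
  fixes L :: "nat \<Rightarrow> 'a"
  assumes "\<And>i. L (i + n) = L i"
  shows "L (i mod n) = L i"
proof -
  have "L (r + q * n) = L r" for r q
    by (induction q) (use assms in \<open>auto simp: add.assoc add.left_commute\<close>, metis assms add.commute add.left_commute)
  from this[of "i mod n" "i div n"] show ?thesis by simp
qed

lemma bij_betw_rotate_mod:
  assumes "(n::nat) > 0"
  shows "bij_betw (\<lambda>i. (p + i) mod n) {..<n} {..<n}"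
proof -
  have inj: "inj_on (\<lambda>i. (p + i) mod n) {..<n}"
  proof (rule inj_onI)
    fix x y assume xy: "x \<in> {..<n}" "y \<in> {..<n}" "(p + x) mod n = (p + y) mod n"
    then obtain q r where "p + x + n * q = p + y + n * r" by (metis nat_mod_eq_iff)
    hence "(x + n * q) mod n = (y + n * r) mod n" by simp
    thus "x = y" using xy by simp
  qed
  moreover have "(\<lambda>i. (p + i) mod n) ` {..<n} = {..<n}"
    by (rule endo_inj_surj) (use assms inj in auto)
  ultimately show ?thesis by (simp add: bij_betw_def)
qed

lemma card_rotate:
  fixes L :: "nat \<Rightarrow> 'a"
  assumes "n > 0" and per: "\<And>i. L (i + n) = L i"
  shows "card {i. i < n \<and> L (p + i) = c} = card {i. i < n \<and> L i = c}"
proof -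
  have "bij_betw (\<lambda>i. (p + i) mod n) {i \<in> {..<n}. L (p + i) = c} {i \<in> {..<n}. L i = c}"
    by (rule bij_betw_Collect[OF bij_betw_rotate_mod[OF assms(1)]]) (simp add: periodic_mod[where L = L and n = n, OF per])
  from bij_betw_same_card[OF this] show ?thesis by simp
qed

lemma image_rotate:
  fixes L :: "nat \<Rightarrow> 'a"
  assumes "n > 0" and per: "\<And>i. L (i + n) = L i"
  shows "(\<lambda>i. L (p + i)) ` {..<n} = L ` {..<n}"
proof -
  have "(\<lambda>i. L (p + i)) ` {..<n} = L ` (\<lambda>i. (p + i) mod n) ` {..<n}"
    by (simp add: image_image periodic_mod[where L = L and n = n, OF per])
  thus ?thesis using bij_betw_rotate_mod[OF assms(1)] by (simp add: bij_betw_def)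
qed

text \<open>The value \<^const>\<open>None\<close> stands for a deleted vertex, the other colours for components.\<close>

locale coloured_cycle =
  fixes n :: nat and L :: "nat \<Rightarrow> 'a option"
  assumes periodic: "L (i + n) = L i"
    and step1: "L i \<noteq> None \<Longrightarrow> L (i + 1) \<noteq> None \<Longrightarrow> L (i + 1) = L i"
    and step3: "L i \<noteq> None \<Longrightarrow> L (i + 3) \<noteq> None \<Longrightarrow> L (i + 3) = L i"
    and two_colours: "card (L ` {..<n} - {None}) > 1"
begin

text \<open>For \<open>c = None\<close> these are the pairs of consecutive deleted vertices. Over
  all values of \<open>c\<close> the sets sort the deleted vertices by the colour of their
  predecessor.\<close>

definition exits :: "'a option \<Rightarrow> nat set" where
  "exits c = {i. i < n \<and> L i = c \<and> L (i + 1) = None}"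

lemma n_pos: "n > 0"
  using two_colours by (cases n) auto

text \<open>Serves to move an irregular place to position 0, where \<open>surplus_double_gap\<close>
  and \<open>surplus_long_run\<close> expect it.\<close>

lemma rotate: "coloured_cycle n (\<lambda>i. L (p + i))"
  using periodic[of "p + _"] step1[of "p + _"] step3[of "p + _"] two_colours
    image_rotate[where L = L and n = n, OF n_pos periodic, of p]
  by unfold_locales (simp_all add: add.assoc)

lemma other_colour: obtains w where "w < n" "L w \<noteq> None" "L w \<noteq> c"
proof -
  have "\<not> L ` {..<n} - {None} \<subseteq> {c}"
    using two_colours card_mono[of "{c}" "L ` {..<n} - {None}"] by auto
  thus thesis using that by blast
qed

text \<open>By \<open>step1\<close>, a colour survives each step to a neighbour that is not deleted,
  so it can be lost only by stepping onto a deleted vertex.\<close>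

lemma exit_between:
  assumes "v \<le> w" "L v \<noteq> None" "L w \<noteq> L v"
  obtains y where "v \<le> y" "y < w" "L y = L v" "L (y + 1) = None"
proof -
  have "\<exists>y. v \<le> y \<and> y < w \<and> L y = L v \<and> L (y + 1) = None"
  proof (rule ccontr)
    assume no: "\<not> ?thesis"
    have "u \<le> w \<longrightarrow> L u = L v" if "v \<le> u" for u
      using that
    proof (induction u rule: dec_induct)
      case (step m)
      show ?case
      proof
        assume "Suc m \<le> w"
        with step have "m < w" "L m = L v" by auto
        with no step have "L (m + 1) \<noteq> None" by simp
        with step1[of m] \<open>L m = L v\<close> assms(2) show "L (Suc m) = L v" by auto
      qed
    qed simp
    with assms show False by blast
  qed
  thus thesis using that by blast
qed

lemma exits_nonempty:
  assumes "c \<in> L ` {..<n} - {None}"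
  shows "card (exits c) \<ge> 1"
proof -
  obtain v where v: "v < n" "L v = c" "c \<noteq> None" using assms by auto
  obtain w where w: "w < n" "L w \<noteq> None" "L w \<noteq> c" by (rule other_colour)
  \<comment> \<open>One full turn is added so that the vertex of another colour comes after
    \<open>v\<close>.\<close>
  have "L (w + n) \<noteq> L v" using w v periodic by simp
  then obtain y where y: "L y = c" "L (y + 1) = None"
    using exit_between[of v "w + n"] v by auto
  have "L (y mod n) = L y" by (rule periodic_mod) (rule periodic)
  moreover have "L (y mod n + 1) = L (y + 1)"
    using periodic_mod[of "\<lambda>i. L (i + 1)" n y] periodic[of "_ + 1"] by (simp add: add.commute add.left_commute)
  ultimately have "y mod n \<in> exits c" using y n_pos by (simp add: exits_def)
  moreover have "finite (exits c)" by (simp add: exits_def)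
  ultimately show ?thesis by (metis One_nat_def Suc_leI card_gt_0_iff empty_iff)
qed

lemma card_None_eq:
  "card {i. i < n \<and> L i = None} = card (exits None) + (\<Sum>c\<in>L ` {..<n} - {None}. card (exits c))"
proof -
  let ?K = "L ` {..<n} - {None}"
  \<comment> \<open>The shift by 1 passes from a deleted vertex to its predecessor, whose colour
    decides which set of exits counts it.\<close>
  have "card {i. i < n \<and> L i = None} = card {i. i < n \<and> L (1 + i) = None}"
    by (rule card_rotate[symmetric]) (use n_pos periodic in auto)
  also have "{i. i < n \<and> L (1 + i) = None} = (\<Union>c\<in>insert None ?K. exits c)"
    unfolding exits_def add.commute[of 1] by blast
  also have "card \<dots> = (\<Sum>c\<in>insert None ?K. card (exits c))"
    by (rule card_UN_disjoint) (auto simp: exits_def)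
  also have "\<dots> = card (exits None) + (\<Sum>c\<in>?K. card (exits c))"
    by (rule sum.insert) auto
  finally show ?thesis .
qed

lemma card_colours_le:
  "card (L ` {..<n} - {None}) + card (exits None) \<le> card {i. i < n \<and> L i = None}"
proof -
  have "card (L ` {..<n} - {None}) = (\<Sum>c\<in>L ` {..<n} - {None}. 1)" by simp
  also have "\<dots> \<le> (\<Sum>c\<in>L ` {..<n} - {None}. card (exits c))"
    by (rule sum_mono) (rule exits_nonempty)
  finally show ?thesis using card_None_eq by simp
qed

text \<open>Keeps the exact count for \<open>c\<close> and the bound 1 for every other colour: each
  exit of \<open>c\<close> after the first, and each pair of consecutive deleted vertices, adds one
  to the surplus.\<close>

lemma card_colours_le':
  assumes "c \<in> L ` {..<n} - {None}"
  shows "card (L ` {..<n} - {None}) + card (exits c) - 1 + card (exits None)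
    \<le> card {i. i < n \<and> L i = None}"
proof -
  let ?K = "L ` {..<n} - {None}"
  have "card (?K - {c}) = (\<Sum>c\<in>?K - {c}. 1)" by simp
  also have "\<dots> \<le> (\<Sum>c\<in>?K - {c}. card (exits c))"
    by (rule sum_mono) (use exits_nonempty in blast)
  finally have "card (?K - {c}) + card (exits c) \<le> (\<Sum>c\<in>?K. card (exits c))"
    using sum.remove[OF _ assms, of "\<lambda>c. card (exits c)"] by simp
  moreover have "card (?K - {c}) = card ?K - 1" "card ?K > 0"
    using assms two_colours by (auto simp: card_Diff_singleton)
  ultimately show ?thesis using card_None_eq by simp
qed

section \<open>Two more deleted vertices than colours\<close>

text \<open>If position 3 is deleted too, there are two consecutive deleted pairs. Otherwise the
  jump from 0 to 3 carries the colour over the gap, so that it is left at 0 and again after 3; this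
  second exit and the pair at 1 make up the surplus.\<close>

lemma surplus_double_gap:
  assumes n: "n > 3" and gap: "L 0 \<noteq> None" "L 1 = None" "L 2 = None"
  shows "card (L ` {..<n} - {None}) + 2 \<le> card {i. i < n \<and> L i = None}"
proof (cases "L 3 = None")
  case True
  have "{1, 2} \<subseteq> exits None" using n gap True by (auto simp: exits_def numeral_2_eq_2 numeral_3_eq_3)
  from card_mono[OF _ this] have "card (exits None) \<ge> 2" by (simp add: exits_def)
  thus ?thesis using card_colours_le by simp
next
  case False
  with gap have 3: "L 3 = L 0" using step3[of 0] by simp
  obtain w where w: "w < n" "L w \<noteq> None" "L w \<noteq> L 0" by (rule other_colour)
  have "3 \<le> w"
  proof (rule ccontr)
    assume "\<not> 3 \<le> w"
    hence "w = 0 \<or> w = 1 \<or> w = 2" by auto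
    thus False using w gap by auto
  qed
  then obtain y where y: "3 \<le> y" "y < w" "L y = L 0" "L (y + 1) = None"
    using exit_between[of 3 w] w 3 gap by auto
  have "{0, y} \<subseteq> exits (L 0)" using n gap y w by (auto simp: exits_def)
  from card_mono[OF _ this] y have "card (exits (L 0)) \<ge> 2" by (simp add: exits_def)
  moreover have "{1} \<subseteq> exits None" using n gap by (auto simp: exits_def numeral_2_eq_2)
  from card_mono[OF _ this] have "card (exits None) \<ge> 1" by (simp add: exits_def)
  moreover have "L 0 \<in> L ` {..<n} - {None}" using gap n_pos by simp
  ultimately show ?thesis using card_colours_le'[of "L 0"] by simp
qed

text \<open>A run of at least two vertices between isolated deleted ones is joined by jumps of
  length 3 to the vertices beyond both of its ends, so its colour is left three times.\<close>

lemma surplus_long_run: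
  assumes n: "n > 3" and gaps: "\<And>i. L i = None \<Longrightarrow> L (i + 1) \<noteq> None"
    and run: "L 0 = None" "L 1 \<noteq> None" "L 2 \<noteq> None"
  shows "card (L ` {..<n} - {None}) + 2 \<le> card {i. i < n \<and> L i = None}"
proof -
  have Ln: "L n = None" using periodic[of 0] run by simp
  have Lpred: "L (n - 1) \<noteq> None"
    using gaps[of "n - 1"] n Ln by auto
  have 2: "L 2 = L 1" using step1[of 1] run by (simp add: numeral_2_eq_2)
  \<comment> \<open>This jump crosses the deleted vertex 0 and extends the colour of the run
    backwards to \<open>n - 1\<close>.\<close>
  have "n - 1 + 3 = 2 + n" using n by simp
  hence "L (n - 1 + 3) = L 2" using periodic[of 2] by simp
  hence last: "L (n - 1) = L 1" using step3[of "n - 1"] Lpred run 2 by simp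
  define e where "e = (LEAST j. j > 0 \<and> L j = None)"
  have "n > 0 \<and> L n = None" using Ln n by simp
  hence e: "e > 0" "L e = None" "e \<le> n"
    unfolding e_def by (metis (mono_tags, lifting) LeastI, metis (mono_tags, lifting) LeastI, metis (mono_tags, lifting) Least_le)
  have before: "L j \<noteq> None" if "0 < j" "j < e" for j
    using that not_less_Least[of j "\<lambda>j. j > 0 \<and> L j = None"] unfolding e_def by simp
  have e3: "e \<ge> 3"
  proof (rule ccontr)
    assume "\<not> e \<ge> 3"
    hence "e = 1 \<or> e = 2" using e by auto
    thus False using e run by auto
  qed
  have same: "L j = L 1" if "0 < j" "j < e" for j
  proof (rule ccontr)
    assume "L j \<noteq> L 1"
    moreover have "1 \<le> j" using that by simp
    ultimately obtain y where "1 \<le> y" "y < j" "L (y + 1) = None"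
      using exit_between[of 1 j] run by auto
    thus False using before[of "y + 1"] that by simp
  qed
  obtain w where w: "w < n" "L w \<noteq> None" "L w \<noteq> L 1" by (rule other_colour)
  have w0: "w > e"
  proof (rule ccontr)
    assume "\<not> w > e"
    hence "w = 0 \<or> w = e \<or> 0 < w \<and> w < e" by auto
    thus False using w same run e by auto
  qed
  have "L (e + 1) \<noteq> None" using gaps e by blast
  \<comment> \<open>The jump across the deleted vertex \<open>e\<close>; as the run has length at
    least 2, \<open>e - 2\<close> still lies in it.\<close>
  moreover have "e - 2 + 3 = e + 1" using e3 by simp
  ultimately have after: "L (e + 1) = L 1"
    using step3[of "e - 2"] same[of "e - 2"] run e3 by simp
  have "e + 1 \<le> w" using w0 by simp
  then obtain y where y: "e + 1 \<le> y" "y < w" "L y = L 1" "L (y + 1) = None"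
    using exit_between[of "e + 1" w] w after run by auto
  \<comment> \<open>The exits are the end of the run, a place between \<open>e\<close> and the other
    colour at \<open>w\<close>, and the vertex before 0. They differ since \<open>e - 1 < y\<close>
    and \<open>y < w \<le> n - 1\<close>.\<close>
  have "{e - 1, y, n - 1} \<subseteq> exits (L 1)"
    using e3 e y w last Ln same[of "e - 1"] n by (auto simp: exits_def)
  moreover have "finite (exits (L 1))" by (simp add: exits_def)
  ultimately have "card {e - 1, y, n - 1} \<le> card (exits (L 1))" by (intro card_mono)
  moreover have "card {e - 1, y, n - 1} = 3" using e3 y w by (auto simp: card_insert_if)
  ultimately have "card (exits (L 1)) \<ge> 3" by simp
  moreover have "L 1 \<in> L ` {..<n} - {None}" using run n by simp
  ultimately show ?thesis using card_colours_le'[of "L 1"] by simp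
qed

lemma surplus:
  assumes "odd n" "n > 3"
  shows "card (L ` {..<n} - {None}) + 2 \<le> card {i. i < n \<and> L i = None}"
proof -
  have transfer: ?thesis
    if "card ((\<lambda>i. L (p + i)) ` {..<n} - {None}) + 2 \<le> card {i. i < n \<and> L (p + i) = None}" for p
    using that image_rotate[where L = L and n = n, OF n_pos periodic, of p] card_rotate[where L = L and n = n, OF n_pos periodic, of p None] by simp
  show ?thesis
  proof (cases "\<exists>i. L i = None \<and> L (i + 1) = None")
    case True
    then obtain i where i: "L i = None" "L (i + 1) = None" by blast
    obtain w where w: "w < n" "L w \<noteq> None" using other_colour by metis
    \<comment> \<open>The bound \<open>i + n\<close> instead of \<open>i\<close> guarantees a vertex
      that is not deleted below it. The last such vertex is followed by two deleted ones, since
      \<open>i + n\<close> and \<open>i + n + 1\<close> are both deleted.\<close>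
    define j where "j = (GREATEST j. j \<le> i + n \<and> L j \<noteq> None)"
    have j: "j \<le> i + n \<and> L j \<noteq> None"
      unfolding j_def by (rule GreatestI_nat[of _ w "i + n"]) (use w in auto)
    have max: "L m = None" if "j < m" "m \<le> i + n" for m
      using that Greatest_le_nat[of "\<lambda>j. j \<le> i + n \<and> L j \<noteq> None" m "i + n"] unfolding j_def by force
    have "L (i + n) = None" "L (i + n + 1) = None"
      using i periodic[of i] periodic[of "i + 1"] by (simp_all add: add.commute add.left_commute)
    hence "L (j + 1) = None" "L (j + 2) = None"
      using j max[of "j + 1"] max[of "j + 2"] by (cases "j = i + n"; cases "j + 1 = i + n"; auto)+
    thus ?thesis
      using coloured_cycle.surplus_double_gap[OF rotate[of j] assms(2)] j by (intro transfer[of j]) simp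
  next
    case False
    hence gaps: "L (i + 1) \<noteq> None" if "L i = None" for i using that by metis
    \<comment> \<open>Otherwise steps of length 2 from a deleted vertex meet only deleted ones. As
      \<open>n + 1\<close> is even, they also reach its successor modulo \<open>n\<close>, against
      \<open>gaps\<close>.\<close>
    have "\<exists>p. L p = None \<and> L (p + 2) \<noteq> None"
    proof (rule ccontr)
      assume no: "\<not> ?thesis"
      obtain w where w: "w < n" "L w \<noteq> None" by (rule other_colour)
      obtain w' where w': "w' < n" "L w' \<noteq> None" "L w' \<noteq> L w" by (rule other_colour)
      have "L (w' + n) \<noteq> L w" using w' periodic by simp
      then obtain y where y: "L (y + 1) = None"
        using exit_between[of w "w' + n"] w by auto
      have "L (y + 1 + 2 * q) = None" for q
      proof (induction q)
        case (Suc q)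
        have "L (y + 1 + 2 * q + 2) = None" using no Suc by metis
        thus ?case by simp
      qed (use y in simp)
      moreover have "even (n + 1)" using assms(1) by simp
      then obtain q where "n + 1 = 2 * q" by (rule evenE)
      ultimately have "L (y + 1 + (n + 1)) = None" by metis
      moreover have "y + 1 + (n + 1) = y + 1 + 1 + n" by simp
      ultimately have "L (y + 1 + 1) = None" using periodic by metis
      thus False using gaps y by blast
    qed
    then obtain p where p: "L p = None" "L (p + 2) \<noteq> None" by blast
    show ?thesis
      using coloured_cycle.surplus_long_run[OF rotate[of p] assms(2)] p gaps[of p] gaps[of "p + _"]
      by (intro transfer[of p]) (simp add: add.assoc)
  qed
qed

end

section \<open>Counting components\<close>

text \<open>A labelling that is constant along edges is constant on components, so evaluating it at
  a chosen representative maps the components onto the labels. Lower bounds on components thus need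
  no description of the classes.\<close>

lemma card_image_le_num_components:
  assumes "finite W" and edge: "\<And>x y. {x, y} \<in> E \<Longrightarrow> f x = f y"
  shows "card (f ` W) \<le> num_components W E"
proof -
  have const: "f x = f y" if "(x, y) \<in> {(x, y). {x, y} \<in> E}\<^sup>*" for x y
    using that by (induction rule: rtrancl_induct) (auto dest: edge)
  have fin: "finite (W // reach W E)"
    by (rule finite_quotient) (use assms(1) in \<open>auto simp: reach_def\<close>)
  have "f w = f (SOME x. x \<in> reach W E `` {w})" if "w \<in> W" for w
  proof -
    have "w \<in> reach W E `` {w}" using that by (simp add: reach_def)
    hence "(SOME x. x \<in> reach W E `` {w}) \<in> reach W E `` {w}" by (rule someI)
    hence "(w, SOME x. x \<in> reach W E `` {w}) \<in> {(x, y). {x, y} \<in> E}\<^sup>*"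
      unfolding reach_def by blast
    thus ?thesis by (rule const)
  qed
  hence "f ` W \<subseteq> (\<lambda>C. f (SOME x. x \<in> C)) ` (W // reach W E)"
    unfolding quotient_def UNION_singleton_eq_range image_image by auto
  thus ?thesis unfolding num_components_def
    using fin by (rule surj_card_le[rotated])
qed

lemma reach_class_eq:
  assumes "{u, v} \<in> E" "u \<in> W" "v \<in> W"
  shows "reach W E `` {u} = reach W E `` {v}"
proof -
  have uv: "(u, v) \<in> {(x, y). {x, y} \<in> E}" "(v, u) \<in> {(x, y). {x, y} \<in> E}"
    using assms(1) by (auto simp: insert_commute)
  have "(u, w) \<in> {(x, y). {x, y} \<in> E}\<^sup>* \<longleftrightarrow> (v, w) \<in> {(x, y). {x, y} \<in> E}\<^sup>*" for w
    using converse_rtrancl_into_rtrancl[OF uv(1)] converse_rtrancl_into_rtrancl[OF uv(2)] by blast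
  thus ?thesis using assms by (auto simp: reach_def)
qed

text \<open>A single cut certifies the bound, and a lower estimate \<open>m\<close> of its number of
  components is enough, because the toughness is nonnegative.\<close>

lemma toughness_less:
  assumes "simple_graph V E" "\<not> complete_graph V E" "X \<subseteq> V"
    and "m \<le> num_components (V - X) (delete_verts E X)" "1 < m" "real (card X) < t * real m"
  shows "toughness V E < ereal t"
proof -
  obtain s where s: "toughness V E = ereal s" "0 \<le> s" "tough s V E"
    using toughness_attained[OF assms(1,2)] by metis
  have "s * real m \<le> s * real (num_components (V - X) (delete_verts E X))"
    using s(2) assms(4) by (intro mult_left_mono) auto
  also have "\<dots> \<le> real (card X)" using s(3) assms(3-5) by (simp add: tough_def)
  finally have "s * real m < t * real m" using assms(6) by simp
  thus ?thesis using s(1) assms(5) by simp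
qed

lemma toughness_eqI:
  assumes "simple_graph V E" "\<not> complete_graph V E" "0 \<le> t" "tough t V E" "X \<subseteq> V"
    and "m \<le> num_components (V - X) (delete_verts E X)" "1 < m" "real (card X) \<le> t * real m"
  shows "toughness V E = ereal t"
proof -
  obtain s where s: "toughness V E = ereal s" "\<And>r. tough r V E \<Longrightarrow> r \<le> s"
    using toughness_attained[OF assms(1,2)] by metis
  \<comment> \<open>\<open>toughness_less\<close> is used contrapositively, with the toughness
    \<open>s\<close> itself as the bound.\<close>
  have "\<not> toughness V E < ereal s" using s(1) by simp
  hence "\<not> real (card X) < s * real m" using toughness_less[OF assms(1,2,5-7)] by blast
  hence "s * real m \<le> t * real m" using assms(8) by simp
  hence "s \<le> t" using assms(7) by simp
  with s assms(4) show ?thesis by force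
qed

section \<open>Circulant graphs\<close>

definition circulant :: "nat \<Rightarrow> nat set \<Rightarrow> nat set set" where
  "circulant n D = {{i, (i + d) mod n} | i d. i < n \<and> d \<in> D}"

lemma doubleton_in_circulant:
  "{u, v} \<in> circulant n D \<longleftrightarrow>
    (\<exists>d\<in>D. u < n \<and> v = (u + d) mod n \<or> v < n \<and> u = (v + d) mod n)" (is "?l = ?r")
proof
  assume ?l
  then obtain i d where "{u, v} = {i, (i + d) mod n}" "i < n" "d \<in> D"
    unfolding circulant_def by blast
  thus ?r unfolding doubleton_eq_iff by metis
next
  assume ?r
  then obtain d where "d \<in> D" "u < n \<and> v = (u + d) mod n \<or> v < n \<and> u = (v + d) mod n" by blast
  thus ?l unfolding circulant_def by (auto simp: insert_commute)
qed

lemma rotate_mod_neq: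
  assumes "(i::nat) < n" "0 < d" "d < n"
  shows "(i + d) mod n \<noteq> i"
  using assms by (cases "i + d < n") (auto simp: le_mod_geq not_less)

lemma simple_graph_circulant:
  assumes "\<And>d. d \<in> D \<Longrightarrow> 0 < d \<and> d < n"
  shows "simple_graph {..<n} (circulant n D)"
  unfolding simple_graph_def
proof (intro conjI ballI)
  fix e assume "e \<in> circulant n D"
  then obtain i d where e: "e = {i, (i + d) mod n}" "i < n" "d \<in> D"
    unfolding circulant_def by blast
  show "e \<subseteq> {..<n}" using e by auto
  have "(i + d) mod n \<noteq> i" using rotate_mod_neq assms e by blast
  thus "card e = 2" using e(1) by (metis card_2_iff)
qed simp

section \<open>Lower bound on the toughness\<close>

lemma tough_circulant_1_3:
  assumes k: "k \<ge> 3"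
  shows "tough ((real k + 1) / (real k - 1)) {..<2 * k + 1} (circulant (2 * k + 1) {1, 3})"
  unfolding tough_def
proof (intro allI impI)
  let ?n = "2 * k + 1"
  fix X assume X: "X \<subseteq> {..<?n}"
  let ?W = "{..<?n} - X"
  let ?E = "delete_verts (circulant ?n {1, 3}) X"
  assume gt: "num_components ?W ?E > 1"
  \<comment> \<open>The colour of a remaining vertex is its component, read periodically.\<close>
  define L where "L i = (if i mod ?n \<in> X then None else Some (reach ?W ?E `` {i mod ?n}))" for i
  have "L ` {..<?n} - {None} = Some ` (?W // reach ?W ?E)"
  proof -
    have "(L ` {..<?n} - {None}) = L ` ?W" using X by (auto simp: L_def)
    also have "\<dots> = Some ` (\<lambda>w. reach ?W ?E `` {w}) ` ?W"
      unfolding image_image by (rule image_cong) (auto simp: L_def)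
    finally show ?thesis by (simp add: quotient_def UNION_singleton_eq_range)
  qed
  hence colours: "card (L ` {..<?n} - {None}) = num_components ?W ?E"
    by (simp add: num_components_def card_image)
  have step: "L (i + d) = L i" if "d \<in> {1, 3}" "L i \<noteq> None" "L (i + d) \<noteq> None" for i d
  proof -
    have "{i mod ?n, (i + d) mod ?n} \<in> circulant ?n {1, 3}"
      unfolding doubleton_in_circulant by (rule bexI[OF _ that(1)]) (simp add: mod_simps)
    moreover have "i mod ?n \<notin> X" "(i + d) mod ?n \<notin> X" using that by (auto simp: L_def split: if_splits)
    ultimately have "reach ?W ?E `` {i mod ?n} = reach ?W ?E `` {(i + d) mod ?n}"
      by (intro reach_class_eq) (auto simp: delete_verts_def)
    thus ?thesis using \<open>i mod ?n \<notin> X\<close> \<open>(i + d) mod ?n \<notin> X\<close> by (simp add: L_def)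
  qed
  interpret coloured_cycle ?n L
  proof
    show "L (i + ?n) = L i" for i by (simp only: L_def mod_add_self2)
    show "L (i + 1) = L i" if "L i \<noteq> None" "L (i + 1) \<noteq> None" for i
      by (rule step) (use that in simp_all)
    show "L (i + 3) = L i" if "L i \<noteq> None" "L (i + 3) \<noteq> None" for i
      by (rule step) (use that in simp_all)
  qed (use gt colours in simp)
  have "{i. i < ?n \<and> L i = None} = X" using X by (auto simp: L_def)
  hence s: "num_components ?W ?E + 2 \<le> card X"
    using surplus k colours by simp
  have "num_components ?W ?E \<le> card ?W"
    unfolding num_components_def quotient_def UNION_singleton_eq_range by (rule card_image_le) simp
  also have "card ?W = ?n - card X" using X by (simp add: card_Diff_subset finite_subset)
  \<comment> \<open>With \<open>c\<close> components,
    \<open>c + 2 \<le> card X \<le> 2 * k + 1 - c\<close> gives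
    \<open>2 * c \<le> 2 * k - 1\<close>.\<close>
  finally have "num_components ?W ?E \<le> k - 1" using s k by simp
  hence c: "real (num_components ?W ?E) \<le> real k - 1" using k by linarith
  have "(real k + 1) * real (num_components ?W ?E)
      = (real k - 1) * real (num_components ?W ?E) + 2 * real (num_components ?W ?E)"
    by (simp add: algebra_simps)
  also have "\<dots> \<le> (real k - 1) * (real (num_components ?W ?E) + 2)"
    using c by (simp add: algebra_simps)
  also have "\<dots> \<le> (real k - 1) * real (card X)"
    using s k by (intro mult_left_mono) auto
  finally show "(real k + 1) / (real k - 1) * real (num_components ?W ?E) \<le> real (card X)"
    using k by (simp add: field_simps)
qed

lemma regular_circulant_1_3:
  assumes n: "n \<ge> 7"
  shows "regular_graph 4 {..<n} (circulant n {1, 3})"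
  unfolding regular_graph_def
proof
  fix v assume v: "v \<in> {..<n}"
  \<comment> \<open>Backward jumps by 1 and 3 are written as forward jumps by \<open>n - 1\<close>
    and \<open>n - 3\<close>; \<open>wrap\<close> translates between the two.\<close>
  let ?N = "(\<lambda>i. (v + i) mod n) ` {1, 3, n - 1, n - 3}"
  have wrap: "u = (v + (n - d)) mod n \<longleftrightarrow> v = (u + d) mod n" if "u < n" "d < n" for u d
    using v that by (cases "u + d < n"; cases "v < d") (auto simp: le_mod_geq not_less mod_if)
  have "{e \<in> circulant n {1, 3}. v \<in> e} = (\<lambda>u. {v, u}) ` ?N"
  proof (intro equalityI subsetI)
    fix e assume "e \<in> {e \<in> circulant n {1, 3}. v \<in> e}"
    then obtain i d where e: "e = {i, (i + d) mod n}" "i < n" "d \<in> {1, 3}" "v = i \<or> v = (i + d) mod n"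
      by (auto simp: circulant_def)
    show "e \<in> (\<lambda>u. {v, u}) ` ?N"
    proof (cases "v = i")
      case True
      thus ?thesis using e by blast
    next
      case False
      with e have "e = {v, i}" "v = (i + d) mod n" by auto
      moreover from this have "i = (v + (n - d)) mod n" using wrap[of i d] e n by auto
      ultimately show ?thesis using e(3) by blast
    qed
  next
    fix e assume "e \<in> (\<lambda>u. {v, u}) ` ?N"
    then obtain i where i: "i \<in> {1, 3, n - 1, n - 3}" "e = {v, (v + i) mod n}" by blast
    have "{v, (v + i) mod n} \<in> circulant n {1, 3}"
    proof (cases "i \<in> {1, 3}")
      case True
      thus ?thesis using v unfolding doubleton_in_circulant by blast
    next
      case False
      then obtain d where d: "d \<in> {1, 3}" "i = n - d" using i(1) by blast
      have "(v + i) mod n < n" "d < n" using n d(1) by auto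
      hence "v = ((v + i) mod n + d) mod n" using wrap[of "(v + i) mod n" d] d(2) by simp
      thus ?thesis using \<open>(v + i) mod n < n\<close> d(1) unfolding doubleton_in_circulant by blast
    qed
    thus "e \<in> {e \<in> circulant n {1, 3}. v \<in> e}" using i(2) by simp
  qed
  moreover have "inj_on (\<lambda>u. {v, u}) ?N"
    by (auto simp: inj_on_def doubleton_eq_iff)
  moreover have "inj_on (\<lambda>i. (v + i) mod n) {1, 3, n - 1, n - 3}"
    by (rule inj_on_subset[of _ "{..<n}"]) (use bij_betw_rotate_mod[of n v] n in \<open>auto simp: bij_betw_def\<close>)
  moreover have "card {1, 3, n - 1, n - 3} = 4" using n by (auto simp: card_insert_if)
  ultimately show "card {e \<in> circulant n {1, 3}. v \<in> e} = 4"
    by (simp only: card_image)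
qed

text \<open>The vertices 0 and 2 are not adjacent. Allowing subsets of the edge set covers the graph
  with an edge deleted.\<close>

lemma not_complete_circulant_1_3:
  assumes "n \<ge> 7" "E \<subseteq> circulant n {1, 3}"
  shows "\<not> complete_graph {..<n} E"
proof -
  have "{0, 2} \<notin> circulant n {1, 3}" using assms(1) by (auto simp: doubleton_in_circulant)
  hence "{0, 2} \<notin> E" using assms(2) by blast
  thus ?thesis using assms(1) unfolding complete_graph_def by force
qed

section \<open>Cuts bounding the toughness from above\<close>

text \<open>\<open>W\<close> is the set of vertices to keep, placed as if \<open>j\<close> were 0,
  and \<open>f\<close> labels their components. Rotation by \<open>j\<close> lets one pattern treat
  every edge of a given jump; only \<open>e\<close> is expressed in rotated positions.\<close>

lemma rotated_cut:
  fixes f :: "nat \<Rightarrow> 'a"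
  assumes n: "n > 0" and j: "j < n" and W: "W \<subseteq> {..<n}"
    and f: "\<And>a d. a \<in> W \<Longrightarrow> d \<in> D \<Longrightarrow> (a + d) mod n \<in> W \<Longrightarrow>
      {(j + a) mod n, (j + a + d) mod n} \<noteq> e \<Longrightarrow> f a = f ((a + d) mod n)"
  obtains X where "X \<subseteq> {..<n}" "card X = n - card W"
    "card (f ` W) \<le> num_components ({..<n} - X) (delete_verts (circulant n D - {e}) X)"
proof -
  let ?h = "\<lambda>i. (j + i) mod n"
  let ?r = "\<lambda>v. (v + (n - j)) mod n"
  let ?X = "{..<n} - ?h ` W"
  have hr: "?h (?r v) = v" if "v < n" for v
  proof -
    have "?h (?r v) = (j + (v + (n - j))) mod n" by (simp add: mod_simps)
    also have "j + (v + (n - j)) = v + n" using j by simp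
    finally show ?thesis using that by simp
  qed
  have rh: "?r (?h a) = a" if "a < n" for a
  proof -
    have "?r (?h a) = (j + a + (n - j)) mod n" by (simp add: mod_simps)
    also have "j + a + (n - j) = a + n" using j by simp
    finally show ?thesis using that by simp
  qed
  have sub: "?h ` W \<subseteq> {..<n}" using n by auto
  have "inj_on ?h W" using bij_betw_rotate_mod[OF n, of j] W by (auto simp: bij_betw_def inj_on_subset)
  hence cX: "card ?X = n - card W"
    using sub by (simp add: card_Diff_subset finite_subset card_image)
  have VX: "{..<n} - ?X = ?h ` W" using sub by auto
  have step: "f (?r u) = f (?r ((u + d) mod n))"
    if prems: "u \<in> ?h ` W" "(u + d) mod n \<in> ?h ` W" "d \<in> D" "{u, (u + d) mod n} \<noteq> e" for u d
  proof -
    obtain a where a: "a \<in> W" "u = ?h a" using prems(1) by blast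
    obtain b where b: "b \<in> W" "(u + d) mod n = ?h b" using prems(2) by blast
    have an: "a < n" "b < n" using a b W by auto
    have ud: "(u + d) mod n = ?h ((a + d) mod n)" using a by (simp add: mod_simps add.assoc)
    have "b = (a + d) mod n" using b(2) ud rh[of b] rh[of "(a + d) mod n"] an n by simp
    moreover have "(j + a + d) mod n = (u + d) mod n" using a by (simp add: mod_simps)
    ultimately have "f a = f ((a + d) mod n)"
      using f[of a d] a b prems by simp
    thus ?thesis using rh[of a] rh[of "(a + d) mod n"] an n a ud by simp
  qed
  have "card ((\<lambda>v. f (?r v)) ` ?h ` W) \<le> num_components (?h ` W) (delete_verts (circulant n D - {e}) ?X)"
  proof (rule card_image_le_num_components)
    show "finite (?h ` W)" using sub finite_subset by blast
    fix x y assume xy: "{x, y} \<in> delete_verts (circulant n D - {e}) ?X"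
    hence E: "{x, y} \<in> circulant n D" "{x, y} \<noteq> e" by (auto simp: delete_verts_def)
    hence "x < n" "y < n" using n by (auto simp: doubleton_in_circulant)
    with xy have in_W: "x \<in> ?h ` W" "y \<in> ?h ` W" by (auto simp: delete_verts_def)
    consider d where "d \<in> D" "y = (x + d) mod n" | d where "d \<in> D" "x = (y + d) mod n"
      using E(1) unfolding doubleton_in_circulant by blast
    thus "f (?r x) = f (?r y)"
    proof cases
      case 1
      thus ?thesis using step[of x d] in_W E(2) by simp
    next
      case 2
      thus ?thesis using step[of y d] in_W E(2) by (simp add: insert_commute)
    qed
  qed
  moreover have "(\<lambda>v. f (?r v)) ` ?h ` W = f ` W"
    unfolding image_image by (rule image_cong) (use rh W in auto)
  ultimately show thesis using that[of ?X] cX VX by auto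
qed

lemma card_odds: "card ((\<lambda>i::nat. 2 * i + 1) ` {a..<b}) = b - a"
  by (simp add: card_image inj_on_def)

text \<open>An odd jump from an odd vertex yields a positive even number, so it can hit the set only
  by wrapping around. Parity excludes the sum \<open>2 * k + 1\<close>, and the only larger sum
  possible is \<open>2 * k + 2\<close>, from \<open>2 * k - 1\<close> by 3.\<close>

lemma jump_from_odd:
  fixes i k d :: nat
  assumes "i < k" "d \<in> {1, 3}" "(2 * i + 1 + d) mod (2 * k + 1) \<in> insert 0 ((\<lambda>i. 2 * i + 1) ` {0..<k})"
  shows "2 * i + 1 = 2 * k - 1 \<and> d = 3 \<and> (2 * i + 1 + d) mod (2 * k + 1) = 1"
proof (cases "2 * i + 1 + d < 2 * k + 1")
  case True
  with assms(3) obtain m where "2 * i + 1 + d = 2 * m + 1"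
    unfolding mod_less[OF True] by auto
  hence "even d" by presburger
  thus ?thesis using assms(2) by auto
next
  case False
  have "2 * i + 1 + d \<noteq> 2 * k + 1" using assms(2) by auto presburger+
  with False have "i + 1 = k" "d = 3" using assms(1,2) by auto
  thus ?thesis by (auto simp: le_mod_geq)
qed

lemma no_jump_from_odd:
  fixes i k d :: nat
  assumes "i < k" "d \<in> {1, 3}"
  shows "(2 * i + 1 + d) mod (2 * k + 1) \<notin> insert 0 ((\<lambda>i. 2 * i + 1) ` {1..<k})"
proof
  assume mem: "(2 * i + 1 + d) mod (2 * k + 1) \<in> insert 0 ((\<lambda>i. 2 * i + 1) ` {1..<k})"
  moreover have "{1..<k} \<subseteq> {0..<k}" by auto
  ultimately have "(2 * i + 1 + d) mod (2 * k + 1) \<in> insert 0 ((\<lambda>i. 2 * i + 1) ` {0..<k})" by blast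
  hence "(2 * i + 1 + d) mod (2 * k + 1) = 1" using jump_from_odd[OF assms] by metis
  thus False using mem by auto
qed

lemma cut_intact:
  assumes k: "k \<ge> 3"
  shows "\<exists>X\<subseteq>{..<2 * k + 1}. card X = k + 1 \<and>
    k - 1 \<le> num_components ({..<2 * k + 1} - X) (delete_verts (circulant (2 * k + 1) {1, 3}) X)"
proof -
  let ?n = "2 * k + 1"
  let ?O = "(\<lambda>i. 2 * i + 1) ` {1..<k}"
  \<comment> \<open>The label of 0 becomes 3 because \<open>{0, 3}\<close> is the only edge among
    the kept vertices.\<close>
  let ?f = "\<lambda>v. if v = 0 then 3 else v"
  have cW: "card (insert 0 ?O) = k" using k card_odds[of 1 k] by (subst card_insert_disjoint) auto
  have W: "insert 0 ?O \<subseteq> {..<?n}" by auto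
  have "?O \<subseteq> ?f ` insert 0 ?O" by force
  hence "card ?O \<le> card (?f ` insert 0 ?O)" by (intro card_mono) simp_all
  hence cf: "k - 1 \<le> card (?f ` insert 0 ?O)" unfolding card_odds .
  \<comment> \<open>The empty set is no edge, so deleting it turns \<open>rotated_cut\<close> into a
    statement on the intact graph.\<close>
  have E: "circulant ?n {1, 3} - {{}} = circulant ?n {1, 3}" by (auto simp: circulant_def)
  show ?thesis
  proof (rule rotated_cut[of ?n 0 "insert 0 ?O" "{1, 3}" "{}" ?f])
    fix a d assume a: "a \<in> insert 0 ?O" and d: "d \<in> {1, 3::nat}" and ad: "(a + d) mod ?n \<in> insert 0 ?O"
    show "?f a = ?f ((a + d) mod ?n)"
    proof (cases "a = 0")
      case True
      with ad d k have "d = 3" by auto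
      with True k show ?thesis by auto
    next
      case False
      then obtain i where i: "a = 2 * i + 1" "i < k" using a by auto
      show ?thesis using no_jump_from_odd[OF i(2) d] ad unfolding i(1) ..
    qed
  next
    fix X assume "X \<subseteq> {..<?n}" "card X = ?n - card (insert 0 ?O)"
      "card (?f ` insert 0 ?O) \<le> num_components ({..<?n} - X) (delete_verts (circulant ?n {1, 3} - {{}}) X)"
    thus ?thesis using cW cf unfolding E by (intro exI[of _ X]) auto
  qed (use W in auto)
qed

text \<open>After rotation \<open>e\<close> is \<open>{0, 3}\<close>, the only edge of the pattern
  in \<open>cut_intact\<close>. Its deletion isolates all \<open>k\<close> kept vertices, hence the
  labelling \<open>id\<close>.\<close>

lemma cut_jump_3:
  assumes k: "k \<ge> 3" and j: "j < 2 * k + 1"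
    and e: "e = {j, (j + 3) mod (2 * k + 1)}"
  shows "\<exists>X\<subseteq>{..<2 * k + 1}. card X = k + 1 \<and>
    k \<le> num_components ({..<2 * k + 1} - X) (delete_verts (circulant (2 * k + 1) {1, 3} - {e}) X)"
proof -
  let ?n = "2 * k + 1"
  let ?O = "(\<lambda>i. 2 * i + 1) ` {1..<k}"
  have cW: "card (insert 0 ?O) = k" using k card_odds[of 1 k] by (subst card_insert_disjoint) auto
  have W: "insert 0 ?O \<subseteq> {..<?n}" by auto
  show ?thesis
  proof (rule rotated_cut[of ?n j "insert 0 ?O" "{1, 3}" e id])
    fix a d assume a: "a \<in> insert 0 ?O" and d: "d \<in> {1, 3::nat}" and ad: "(a + d) mod ?n \<in> insert 0 ?O"
      and ne: "{(j + a) mod ?n, (j + a + d) mod ?n} \<noteq> e"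
    have False
    proof (cases "a = 0")
      case True
      with ad d k have "d = 3" by auto
      with True ne e j show False by simp
    next
      case False
      then obtain i where i: "a = 2 * i + 1" "i < k" using a by auto
      show False using no_jump_from_odd[OF i(2) d] ad unfolding i(1) ..
    qed
    thus "id a = id ((a + d) mod ?n)" ..
  next
    fix X assume "X \<subseteq> {..<?n}" "card X = ?n - card (insert 0 ?O)"
      "card (id ` insert 0 ?O) \<le> num_components ({..<?n} - X) (delete_verts (circulant ?n {1, 3} - {e}) X)"
    thus ?thesis using cW by (intro exI[of _ X]) auto
  qed (use W j in auto)
qed

lemma cut_jump_1:
  assumes k: "k \<ge> 3" and j: "j < 2 * k + 1"
    and e: "e = {j, (j + 1) mod (2 * k + 1)}"
  shows "\<exists>X\<subseteq>{..<2 * k + 1}. card X = k \<and>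
    k - 1 \<le> num_components ({..<2 * k + 1} - X) (delete_verts (circulant (2 * k + 1) {1, 3} - {e}) X)"
proof -
  let ?n = "2 * k + 1"
  let ?O = "(\<lambda>i. 2 * i + 1) ` {0..<k}"
  \<comment> \<open>Once \<open>{0, 1}\<close> is deleted, the remaining edges among the kept
    vertices are \<open>{0, 3}\<close> and \<open>{2 * k - 1, 1}\<close>. The labels left are the
    odd numbers up to \<open>2 * k - 3\<close>.\<close>
  let ?f = "\<lambda>v. if v = 0 then 3 else if v = 2 * k - 1 then 1 else v"
  have cW: "card (insert 0 ?O) = k + 1" using card_odds[of 0 k] by (subst card_insert_disjoint) auto
  have W: "insert 0 ?O \<subseteq> {..<?n}" by auto
  have "(\<lambda>i. 2 * i + 1) ` {0..<k - 1} \<subseteq> ?f ` insert 0 ?O"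
  proof
    fix v assume "v \<in> (\<lambda>i. 2 * i + 1) ` {0..<k - 1}"
    then obtain i where "v = 2 * i + 1" "i < k - 1" by auto
    hence "v = ?f v" "v \<in> insert 0 ?O" by auto
    thus "v \<in> ?f ` insert 0 ?O" by blast
  qed
  hence "card ((\<lambda>i. 2 * i + 1) ` {0..<k - 1}) \<le> card (?f ` insert 0 ?O)" by (intro card_mono) simp_all
  hence cf: "k - 1 \<le> card (?f ` insert 0 ?O)" unfolding card_odds by simp
  show ?thesis
  proof (rule rotated_cut[of ?n j "insert 0 ?O" "{1, 3}" e ?f])
    fix a d assume a: "a \<in> insert 0 ?O" and d: "d \<in> {1, 3::nat}" and ad: "(a + d) mod ?n \<in> insert 0 ?O"
      and ne: "{(j + a) mod ?n, (j + a + d) mod ?n} \<noteq> e"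
    show "?f a = ?f ((a + d) mod ?n)"
    proof (cases "a = 0")
      case True
      with ne e j d have "d = 3" by auto
      with True k show ?thesis by auto
    next
      case False
      then obtain i where i: "a = 2 * i + 1" "i < k" using a by auto
      have "a = 2 * k - 1 \<and> d = 3 \<and> (a + d) mod ?n = 1"
        using jump_from_odd[OF i(2) d] ad unfolding i(1) .
      thus ?thesis using k by auto
    qed
  next
    fix X assume "X \<subseteq> {..<?n}" "card X = ?n - card (insert 0 ?O)"
      "card (?f ` insert 0 ?O) \<le> num_components ({..<?n} - X) (delete_verts (circulant ?n {1, 3} - {e}) X)"
    thus ?thesis using cW cf by (intro exI[of _ X]) auto
  qed (use W j in auto)
qed

theorem theorem1p6:
  fixes k :: nat
  assumes "k \<ge> 3"
  shows "\<exists>(V :: nat set) (E :: nat set set).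
           simple_graph V E \<and> card V = 2 * k + 1 \<and> regular_graph 4 V E \<and>
           minimally_tough ((real k + 1) / (real k - 1)) V E"
proof -
  let ?n = "2 * k + 1"
  let ?V = "{..<?n}"
  let ?E = "circulant ?n {1, 3}"
  let ?t = "(real k + 1) / (real k - 1)"
  have simple: "simple_graph ?V ?E" by (rule simple_graph_circulant) (use assms in auto)
  have "toughness ?V ?E = ereal ?t"
  proof -
    obtain X where X: "X \<subseteq> ?V" "card X = k + 1"
      "k - 1 \<le> num_components (?V - X) (delete_verts ?E X)"
      using cut_intact[OF assms] by blast
    have nc: "\<not> complete_graph ?V ?E" by (rule not_complete_circulant_1_3) (use assms in auto)
    \<comment> \<open>The cut is tight: \<open>?t * (k - 1) = k + 1\<close>.\<close>
    show ?thesis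
      by (rule toughness_eqI[OF simple nc _ tough_circulant_1_3[OF assms] X(1,3)])
        (use assms X(2) in \<open>auto simp: of_nat_diff\<close>)
  qed
  moreover have "toughness ?V (?E - {e}) < ereal ?t" if e: "e \<in> ?E" for e
  proof -
    have simple': "simple_graph ?V (?E - {e})" using simple by (auto simp: simple_graph_def)
    have nc: "\<not> complete_graph ?V (?E - {e})" by (rule not_complete_circulant_1_3) (use assms in auto)
    obtain j d where j: "j < ?n" "e = {j, (j + d) mod ?n}" "d = 1 \<or> d = 3"
      using e unfolding circulant_def by blast
    from j(3) show ?thesis
    proof
      assume "d = 1"
      then obtain X where X: "X \<subseteq> ?V" "card X = k"
        "k - 1 \<le> num_components (?V - X) (delete_verts (?E - {e}) X)"
        using cut_jump_1[OF assms j(1), of e] j(2) by blast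
      \<comment> \<open>Here \<open>k < k + 1 = ?t * (k - 1)\<close>.\<close>
      show ?thesis
        by (rule toughness_less[OF simple' nc X(1,3)]) (use assms X(2) in \<open>auto simp: of_nat_diff\<close>)
    next
      assume "d = 3"
      then obtain X where X: "X \<subseteq> ?V" "card X = k + 1"
        "k \<le> num_components (?V - X) (delete_verts (?E - {e}) X)"
        using cut_jump_3[OF assms j(1), of e] j(2) by blast
      \<comment> \<open>Here \<open>k + 1 = ?t * (k - 1) < ?t * k\<close>.\<close>
      show ?thesis
        by (rule toughness_less[OF simple' nc X(1,3)]) (use assms X(2) in \<open>auto simp: field_simps\<close>)
    qed
  qed
  ultimately have "minimally_tough ?t ?V ?E" by (simp add: minimally_tough_def)
  moreover have "regular_graph 4 ?V ?E" by (rule regular_circulant_1_3) (use assms in auto)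
  ultimately show ?thesis using simple by (intro exI[of _ ?V] exI[of _ ?E]) simp
qed

end
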